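(* Let $M\in\mathbb{R}^{m\times n}$, $\lambda>0$, let $\{\omega_{ij}\}$ be a general basis of $\mathbb{R}^{m\times n}$ and $\mathcal{K}_{obs}$ a set of index pairs. Consider the extended robust LRR problem $$\text{(LRR)}\quad \min_{Z,L,S}\ \|Z\|_*+\lambda\|S\|_{2,1}\quad\text{s.t.}\quad L=LZ,\ \ \langle M,\omega_{ij}\rangle=\langle L+S,\omega_{ij}\rangle,\ (i,j)\in\mathcal{K}_{obs},$$ and the (original) extended robust MC problem $$\text{(MC)}\quad \min_{L,S}\ \mathrm{rank}(L)+\lambda\|S\|_{2,1}\quad\text{s.t.}\quad \langle M,\omega_{ij}\rangle=\langle L+S,\omega_{ij}\rangle,\ (i,j)\in\mathcal{K}_{obs}.$$ If $(L^*,S^* )$ is a solution to (MC), then $((L^* )^\dagger L^*,L^*,S^* )$ is optimal for (LRR). Conversely, if $(Z^*,L^*,S^* )$ is a solution to (LRR), then $(L^*,S^* )$ is optimal for (MC).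
   Context: $\|\cdot\|_*$ is the nuclear norm, $\|S\|_{2,1}=\sum_j\|S_{:j}\|_2$ where $S_{:j}$ is the $j$th column, $\langle A,B\rangle=\mathrm{tr}(A^TB)$, and $A^\dagger$ is the Moore-Penrose pseudo-inverse. General basis: an orthonormal basis $\{\omega_{ij}\}$ of $\mathbb{R}^{m\times n}$ with $\mathrm{Span}\{\omega_{ij}:i=1,\dots,m\}=\mathrm{Span}\{e_ie_j^T:i=1,\dots,m\}$ for every $j$. *)

theory Defs
  imports "HOL-Analysis.Analysis"
begin

text \<open>An \<open>m \<times> n\<close> real matrix is an element of \<^typ>\<open>real ^ 'n ^ 'm\<close>, with rows indexed by
  \<open>'m\<close> and columns indexed by \<open>'n\<close>.\<close>

definition mat_inner :: "real ^ 'n ^ 'm \<Rightarrow> real ^ 'n ^ 'm \<Rightarrow> real" where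
  "mat_inner A B = trace (transpose A ** B)"

definition norm_2_1 :: "real ^ 'n ^ 'm \<Rightarrow> real" where
  "norm_2_1 S = (\<Sum>j\<in>UNIV. norm (column j S))"

text \<open>The eigenspace of \<open>A\<^sup>T A\<close> for the eigenvalue \<open>s\<^sup>2\<close>. Since \<open>A\<^sup>T A\<close> is symmetric, its
  dimension is the multiplicity of \<open>s\<close> as a singular value of \<open>A\<close>.\<close>

definition singular_space :: "real ^ 'n ^ 'm \<Rightarrow> real \<Rightarrow> (real ^ 'n) set" where
  "singular_space A s = {v. (transpose A ** A) *v v = s\<^sup>2 *\<^sub>R v}"

definition singular_values :: "real ^ 'n ^ 'm \<Rightarrow> real set" where
  "singular_values A = {s. 0 \<le> s \<and> (\<exists>v\<in>singular_space A s. v \<noteq> 0)}"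

text \<open>The nuclear norm is the sum of the singular values counted with multiplicity. The set of
  singular values is finite, having at most \<open>n\<close> elements.\<close>

definition nuclear_norm :: "real ^ 'n ^ 'm \<Rightarrow> real" where
  "nuclear_norm A = (\<Sum>s\<in>singular_values A. real (dim (singular_space A s)) * s)"

definition is_pseudo_inverse :: "real ^ 'n ^ 'm \<Rightarrow> real ^ 'm ^ 'n \<Rightarrow> bool" where
  "is_pseudo_inverse A X \<longleftrightarrow>
     A ** X ** A = A \<and> X ** A ** X = X \<and>
     transpose (A ** X) = A ** X \<and> transpose (X ** A) = X ** A"

definition pseudo_inverse :: "real ^ 'n ^ 'm \<Rightarrow> real ^ 'm ^ 'n" where
  "pseudo_inverse A = (THE X. is_pseudo_inverse A X)"

text \<open>The matrix \<open>e\<^sub>i e\<^sub>j\<^sup>T\<close>.\<close>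

definition mat_unit :: "'m \<Rightarrow> 'n \<Rightarrow> real ^ 'n ^ 'm" where
  "mat_unit i j = (\<chi> k l. if k = i \<and> l = j then 1 else 0)"

definition general_basis :: "('m \<Rightarrow> 'n \<Rightarrow> real ^ 'n ^ 'm) \<Rightarrow> bool" where
  "general_basis \<omega> \<longleftrightarrow>
     (\<forall>i j k l. mat_inner (\<omega> i j) (\<omega> k l) = (if i = k \<and> j = l then 1 else 0)) \<and>
     span {\<omega> i j | i j. True} = UNIV \<and>
     (\<forall>j. span {\<omega> i j | i. True} = span {mat_unit i j | i. True})"

definition obs_constraint ::
  "real ^ 'n ^ 'm \<Rightarrow> ('m \<Rightarrow> 'n \<Rightarrow> real ^ 'n ^ 'm) \<Rightarrow> ('m \<times> 'n) set
     \<Rightarrow> real ^ 'n ^ 'm \<Rightarrow> real ^ 'n ^ 'm \<Rightarrow> bool" where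
  "obs_constraint M \<omega> K L S \<longleftrightarrow>
     (\<forall>(i, j)\<in>K. mat_inner M (\<omega> i j) = mat_inner (L + S) (\<omega> i j))"

definition LRR_solution ::
  "real ^ 'n ^ 'm \<Rightarrow> real \<Rightarrow> ('m \<Rightarrow> 'n \<Rightarrow> real ^ 'n ^ 'm) \<Rightarrow> ('m \<times> 'n) set
     \<Rightarrow> (real ^ 'n ^ 'n) \<times> (real ^ 'n ^ 'm) \<times> (real ^ 'n ^ 'm) \<Rightarrow> bool" where
  "LRR_solution M lam \<omega> K =
     is_arg_min (\<lambda>(Z, L, S). nuclear_norm Z + lam * norm_2_1 S)
                (\<lambda>(Z, L, S). L = L ** Z \<and> obs_constraint M \<omega> K L S)"

definition MC_solution ::
  "real ^ 'n ^ 'm \<Rightarrow> real \<Rightarrow> ('m \<Rightarrow> 'n \<Rightarrow> real ^ 'n ^ 'm) \<Rightarrow> ('m \<times> 'n) set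
     \<Rightarrow> (real ^ 'n ^ 'm) \<times> (real ^ 'n ^ 'm) \<Rightarrow> bool" where
  "MC_solution M lam \<omega> K =
     is_arg_min (\<lambda>(L, S). real (rank L) + lam * norm_2_1 S)
                (\<lambda>(L, S). obs_constraint M \<omega> K L S)"

end

theory Submission
  imports Defs
begin

text \<open>Both implications follow from two facts: \<open>L = L Z\<close> forces \<open>\<parallel>Z\<parallel>\<^sub>* \<ge> rank L\<close>, and
  \<open>Z = L\<^sup>\<dagger> L\<close> attains this bound. For the first, \<open>Z u - u\<close> lies in the null space of \<open>L\<close> and is
  thus orthogonal to the row space, so \<open>u \<bullet> Z u = 1\<close> for each \<open>u\<close> of an orthonormal basis of the
  row space. Expanding in an orthonormal basis \<open>B\<close> of right singular vectors of \<open>Z\<close> bounds the sum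
  of these \<open>rank L\<close> ones by \<open>\<Sum>v\<in>B. \<parallel>Z v\<parallel>\<close>, which is \<open>\<parallel>Z\<parallel>\<^sub>*\<close>. For the second, \<open>L\<^sup>\<dagger> L\<close> is an
  orthogonal projection, whose nuclear norm is its rank.\<close>

subsection \<open>The spectral theorem for the Gram matrix\<close>

text \<open>A maximiser of the Rayleigh quotient on the unit sphere of \<open>S\<close>, which
  exists by compactness, is an eigenvector. The invariant subspace \<open>S\<close> allows the
  result to be applied to the orthogonal complement of eigenvectors already found.\<close>

lemma self_adjoint_unit_eigenvector:
  fixes f :: "'a::euclidean_space \<Rightarrow> 'a"
  assumes lin: "linear f" and adj: "\<And>x y. f x \<bullet> y = x \<bullet> f y"
    and S: "subspace S" and inv: "\<And>x. x \<in> S \<Longrightarrow> f x \<in> S" and ne: "x0 \<in> S" "x0 \<noteq> 0"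
  obtains x where "x \<in> S" "norm x = 1" "f x = (x \<bullet> f x) *\<^sub>R x"
proof -
  let ?K = "S \<inter> sphere 0 1"
  have comp: "compact ?K"
    using S by (simp add: closed_Int_compact closed_subspace)
  have "x0 /\<^sub>R norm x0 \<in> ?K"
    using ne S by (simp add: subspace_scale)
  then have nonempty: "?K \<noteq> {}" by blast
  have "continuous_on ?K (\<lambda>x. x \<bullet> f x)"
    by (intro continuous_intros linear_continuous_on linear_conv_bounded_linear[THEN iffD1] lin)
  from continuous_attains_sup[OF comp nonempty this]
  obtain x where x: "x \<in> S" "norm x = 1"
    and max: "\<And>y. y \<in> S \<Longrightarrow> norm y = 1 \<Longrightarrow> y \<bullet> f y \<le> x \<bullet> f x"
    by auto
  define \<mu> where "\<mu> = x \<bullet> f x"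
  define h where "h y = \<mu> * (y \<bullet> y) - y \<bullet> f y" for y
  have h_nonneg: "0 \<le> h y" if "y \<in> S" for y
  proof (cases "y = 0")
    case True
    then show ?thesis by (simp add: h_def)
  next
    case False
    let ?z = "y /\<^sub>R norm y"
    have "?z \<bullet> f ?z \<le> \<mu>"
      unfolding \<mu>_def using that S False by (intro max) (simp_all add: subspace_scale)
    also have "?z \<bullet> f ?z = (y \<bullet> f y) / (norm y)\<^sup>2"
      by (simp add: linear_scale[OF lin] power2_eq_square field_simps)
    finally show ?thesis
      using False by (simp add: h_def pos_divide_le_eq flip: power2_norm_eq_inner)
  qed
  have h_x: "h x = 0"
    using x by (simp add: h_def \<mu>_def flip: power2_norm_eq_inner)
  define y where "y = \<mu> *\<^sub>R x - f x"
  have y: "y \<in> S"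
    unfolding y_def using x S inv by (simp add: subspace_diff subspace_scale)
  define c where "c = y \<bullet> y"
  have c: "c = \<mu> * (x \<bullet> y) - f x \<bullet> y"
    unfolding c_def by (subst (1) y_def) (simp add: inner_diff_left)
  \<comment> \<open>\<open>x\<close> minimises the quadratic form \<open>h\<close> on \<open>S\<close>, and \<open>2c\<close> is its derivative at \<open>x\<close> along \<open>y\<close>.\<close>
  have expand: "h (x + t *\<^sub>R y) = 2 * t * c + t\<^sup>2 * h y" for t
  proof -
    have "h (x + t *\<^sub>R y) = h x + 2 * t * (\<mu> * (x \<bullet> y) - f x \<bullet> y) + t\<^sup>2 * h y"
      using adj[of x y]
      by (simp add: h_def linear_add[OF lin] linear_scale[OF lin] inner_commute[of y x] inner_commute[of y "f x"] algebra_simps power2_eq_square)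
    then show ?thesis using h_x c by simp
  qed
  have "c = 0"
  proof (rule ccontr)
    assume "c \<noteq> 0"
    \<comment> \<open>Adding 1 keeps the denominator positive even if \<open>h y = 0\<close>; at
      \<open>- c / k\<close> the negative linear term then outweighs the quadratic one.\<close>
    define k where "k = 1 + h y"
    have k: "k \<ge> 1" using h_nonneg[OF y] by (simp add: k_def)
    let ?t = "- c / k"
    have "0 \<le> h (x + ?t *\<^sub>R y)"
      using x y S by (intro h_nonneg subspace_add subspace_scale)
    also have "\<dots> = 2 * ?t * c + ?t\<^sup>2 * (k - 1)"
      by (simp only: expand) (simp add: k_def)
    also have "\<dots> = - (c\<^sup>2 * (k + 1) / k\<^sup>2)"
      using k by (simp add: field_simps power2_eq_square)
    also have "\<dots> < 0"
      using k \<open>c \<noteq> 0\<close> by simp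
    finally show False by simp
  qed
  then have "f x = \<mu> *\<^sub>R x"
    by (simp add: c_def y_def)
  with x that show thesis by (simp add: \<mu>_def)
qed

lemma inner_gram_matrix:
  fixes A :: "real ^ 'n ^ 'm"
  shows "x \<bullet> ((transpose A ** A) *v y) = (A *v x) \<bullet> (A *v y)"
proof -
  have "x \<bullet> (transpose A *v (A *v y)) = (A *v x) \<bullet> (A *v y)"
    by (metis dot_lmul_matrix inner_commute transpose_matrix_vector)
  then show ?thesis
    by (simp only: matrix_vector_mul_assoc)
qed

lemma gram_matrix_self_adjoint:
  fixes A :: "real ^ 'n ^ 'm"
  shows "((transpose A ** A) *v x) \<bullet> y = x \<bullet> ((transpose A ** A) *v y)"
  by (metis inner_commute inner_gram_matrix)

lemma subspace_singular_space: "subspace (singular_space A s)"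
  unfolding singular_space_def subspace_def
  by (auto simp: matrix_vector_right_distrib matrix_vector_mult_scaleR scaleR_add_right)

lemma norm_mult_singular_vector:
  assumes "v \<in> singular_space A s" "0 \<le> s"
  shows "norm (A *v v) = s * norm v"
proof -
  have "(norm (A *v v))\<^sup>2 = v \<bullet> ((transpose A ** A) *v v)"
    by (simp only: inner_gram_matrix power2_norm_eq_inner)
  also have "\<dots> = (s * norm v)\<^sup>2"
    using assms by (simp add: singular_space_def power_mult_distrib power2_norm_eq_inner)
  finally show ?thesis
    using assms by (simp add: power2_eq_iff_nonneg)
qed

lemma singular_spaces_orthogonal:
  assumes "v \<in> singular_space A s" "w \<in> singular_space A t" "0 \<le> s" "0 \<le> t" "s \<noteq> t"
  shows "v \<bullet> w = 0"
proof -
  have "s\<^sup>2 * (v \<bullet> w) = t\<^sup>2 * (v \<bullet> w)"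
    using gram_matrix_self_adjoint[of A v w] assms(1,2) by (simp add: singular_space_def)
  moreover have "s\<^sup>2 \<noteq> t\<^sup>2"
    using assms(3-5) by (simp add: power2_eq_iff_nonneg)
  ultimately show ?thesis by simp
qed

text \<open>Orthonormal bases of the singular spaces are glued together. Each vector for the
  singular value \<open>s\<close> contributes \<open>norm (A *v v) = s\<close>, so the
  multiplicities in \<open>nuclear_norm\<close> become a plain sum over the basis.\<close>

lemma right_singular_basis:
  fixes A :: "real ^ 'n ^ 'm"
  obtains B where "finite B" "pairwise orthogonal B" "\<And>v. v \<in> B \<Longrightarrow> norm v = 1" "span B = UNIV"
    "nuclear_norm A = (\<Sum>v\<in>B. norm (A *v v))"
proof -
  let ?V = "singular_space A"
  have "\<exists>C. C \<subseteq> ?V s \<and> pairwise orthogonal C \<and> (\<forall>v\<in>C. norm v = 1) \<and> finite C \<and>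
          card C = dim (?V s) \<and> span C = ?V s" for s
    by (rule orthonormal_basis_subspace[OF subspace_singular_space[of A s]])
      (meson independent_imp_finite)
  then obtain C where C: "\<And>s. C s \<subseteq> ?V s" "\<And>s. pairwise orthogonal (C s)"
      "\<And>s v. v \<in> C s \<Longrightarrow> norm v = 1" "\<And>s. finite (C s)" "\<And>s. card (C s) = dim (?V s)"
      "\<And>s. span (C s) = ?V s"
    by metis
  define B where "B = (\<Union>s\<in>singular_values A. C s)"
  \<comment> \<open>The vector determines its singular value. This yields both the finiteness of the
    set of singular values and the disjointness of the sets \<open>C s\<close>.\<close>
  have norm_AC: "norm (A *v v) = s" if "s \<in> singular_values A" "v \<in> C s" for s v
    using norm_mult_singular_vector[of v A s] that C(1,3) by (auto simp: singular_values_def)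
  have norm_B: "norm v = 1" if "v \<in> B" for v
    using that C(3) by (auto simp: B_def)
  have orth: "pairwise orthogonal B"
  proof (rule pairwiseI)
    fix v w assume "v \<in> B" "w \<in> B" "v \<noteq> w"
    then obtain s t where st: "s \<in> singular_values A" "t \<in> singular_values A" "v \<in> C s" "w \<in> C t"
      by (auto simp: B_def)
    show "orthogonal v w"
    proof (cases "s = t")
      case True
      then show ?thesis using C(2)[of s] st \<open>v \<noteq> w\<close> by (auto simp: pairwise_def)
    next
      case False
      then show ?thesis
        using singular_spaces_orthogonal[of v A s w t] st C(1)
        by (auto simp: orthogonal_def singular_values_def)
    qed
  qed
  have fin: "finite B"
    using norm_B by (intro independent_imp_finite pairwise_orthogonal_independent orth) fastforce
  have "s \<in> (\<lambda>v. norm (A *v v)) ` B" if s: "s \<in> singular_values A" for s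
  proof -
    obtain v where "v \<in> ?V s" "v \<noteq> 0"
      using s by (auto simp: singular_values_def)
    then have "C s \<noteq> {}"
      using C(6)[of s] by auto
    then show ?thesis
      using s norm_AC by (auto simp: B_def image_iff)
  qed
  then have fin_sv: "finite (singular_values A)"
    using fin by (meson finite_imageI finite_subset subsetI)
  have disj: "C s \<inter> C t = {}" if "s \<in> singular_values A" "t \<in> singular_values A" "s \<noteq> t" for s t
    using norm_AC that by blast
  have "(\<Sum>v\<in>B. norm (A *v v)) = (\<Sum>s\<in>singular_values A. \<Sum>v\<in>C s. norm (A *v v))"
    unfolding B_def using fin_sv C(4) disj by (intro sum.UNION_disjoint) auto
  also have "\<dots> = (\<Sum>s\<in>singular_values A. \<Sum>v\<in>C s. s)"
    using norm_AC by (intro sum.cong) auto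
  also have "\<dots> = nuclear_norm A"
    by (simp add: nuclear_norm_def C(5))
  finally have nn: "nuclear_norm A = (\<Sum>v\<in>B. norm (A *v v))" by simp
  have "span B = UNIV"
  proof (rule ccontr)
    assume "span B \<noteq> UNIV"
    then have "dim B < DIM(real ^ 'n)"
      by (metis dim_eq_full dim_subset_UNIV nat_less_le)
    then obtain x0 where x0: "x0 \<noteq> 0" "\<And>y. y \<in> span B \<Longrightarrow> orthogonal x0 y"
      by (rule orthogonal_to_subspace_exists) blast
    let ?G = "transpose A ** A"
    \<comment> \<open>This is the orthogonal complement of \<open>span B\<close>. It is invariant
      under the Gram matrix, so if it were nonzero it would contain an eigenvector \<open>x\<close>;
      but \<open>x\<close> lies in some singular space, hence in \<open>span B\<close>, and is
      orthogonal to itself.\<close>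
    define S where "S = {y. \<forall>b\<in>B. y \<bullet> b = 0}"
    have sub: "subspace S"
      unfolding S_def subspace_def by (auto simp: inner_add_left)
    have inv: "?G *v y \<in> S" if "y \<in> S" for y
      unfolding S_def
    proof (intro CollectI ballI)
      fix b assume b: "b \<in> B"
      then obtain s where "b \<in> ?V s"
        using C(1) by (auto simp: B_def)
      then have "?G *v b = s\<^sup>2 *\<^sub>R b"
        by (simp add: singular_space_def)
      then show "(?G *v y) \<bullet> b = 0"
        using that b gram_matrix_self_adjoint[of A y b] by (simp add: S_def)
    qed
    have "x0 \<in> S"
      using x0(2) by (auto simp: S_def orthogonal_def span_base)
    then obtain x where x: "x \<in> S" "norm x = 1" "?G *v x = (x \<bullet> (?G *v x)) *\<^sub>R x"
      using self_adjoint_unit_eigenvector[OF matrix_vector_mul_linear[of ?G]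
          gram_matrix_self_adjoint sub inv _ x0(1)]
      by blast
    let ?s = "norm (A *v x)"
    have "x \<bullet> (?G *v x) = ?s\<^sup>2"
      by (simp only: inner_gram_matrix power2_norm_eq_inner)
    then have xV: "x \<in> ?V ?s"
      using x(3) by (simp add: singular_space_def)
    moreover have "x \<noteq> 0" using x(2) by auto
    ultimately have "?s \<in> singular_values A"
      by (auto simp: singular_values_def)
    then have "C ?s \<subseteq> B"
      by (auto simp: B_def)
    with xV have "x \<in> span B"
      using C(6) span_mono by blast
    then have "orthogonal x x"
    proof (rule orthogonal_to_span)
      show "orthogonal x b" if "b \<in> B" for b
        using x(1) that by (simp add: S_def orthogonal_def)
    qed
    with \<open>x \<noteq> 0\<close> show False by (simp add: orthogonal_self)
  qed
  then show thesis
    using that fin orth norm_B nn by blast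
qed

subsection \<open>Nuclear norm and rank\<close>

text \<open>Bessel's inequality: the sum \<open>p\<close> is the orthogonal projection of
  \<open>v\<close> onto \<open>span U\<close>, so \<open>p \<bullet> p = p \<bullet> v\<close>, and
  Cauchy-Schwarz finishes.\<close>

lemma norm_orthonormal_expansion_le:
  fixes v :: "'a::euclidean_space"
  assumes "pairwise orthogonal U" "\<And>u. u \<in> U \<Longrightarrow> norm u = 1" "finite U"
  shows "norm (\<Sum>u\<in>U. (u \<bullet> v) *\<^sub>R u) \<le> norm v"
proof -
  define p where "p = (\<Sum>u\<in>U. (u \<bullet> v) *\<^sub>R u)"
  have p_inner: "u \<bullet> p = u \<bullet> v" if "u \<in> U" for u
  proof -
    have "u \<bullet> p = (\<Sum>w\<in>U. if w = u then u \<bullet> v else 0)"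
      unfolding p_def inner_sum_right
    proof (rule sum.cong[OF refl])
      fix w assume "w \<in> U"
      then show "u \<bullet> ((w \<bullet> v) *\<^sub>R w) = (if w = u then u \<bullet> v else 0)"
        using assms(1,2) that by (auto simp: pairwise_def orthogonal_def norm_eq_1)
    qed
    then show ?thesis
      using that assms(3) by simp
  qed
  have "p \<bullet> p = (\<Sum>u\<in>U. (u \<bullet> v) * (u \<bullet> p))"
    by (subst (1) p_def) (simp add: inner_sum_left)
  also have "\<dots> = (\<Sum>u\<in>U. (u \<bullet> v) * (u \<bullet> v))"
    using p_inner by simp
  also have "\<dots> = p \<bullet> v"
    by (simp add: p_def inner_sum_left)
  finally have "(norm p)\<^sup>2 \<le> norm p * norm v"
    using norm_cauchy_schwarz[of p v] by (simp only: power2_norm_eq_inner)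
  then have "norm p \<le> norm v"
    by (cases "p = 0") (simp_all add: power2_eq_square)
  then show ?thesis by (simp only: p_def)
qed

lemma rank_le_nuclear_norm:
  fixes L :: "real ^ 'n ^ 'm" and Z :: "real ^ 'n ^ 'n"
  assumes "L = L ** Z"
  shows "real (rank L) \<le> nuclear_norm Z"
proof -
  obtain B where B: "finite B" "pairwise orthogonal B" "\<And>v. v \<in> B \<Longrightarrow> norm v = 1"
      "span B = UNIV" "nuclear_norm Z = (\<Sum>v\<in>B. norm (Z *v v))"
    by (rule right_singular_basis[of Z]) blast
  obtain U where U: "U \<subseteq> span (rows L)" "pairwise orthogonal U" "\<And>u. u \<in> U \<Longrightarrow> norm u = 1"
      "independent U" "card U = dim (span (rows L))"
    by (rule orthonormal_basis_subspace[OF subspace_span[of "rows L"]]) blast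
  have finU: "finite U" using U(4) by (rule independent_imp_finite)
  have uZu: "u \<bullet> (Z *v u) = 1" if u: "u \<in> U" for u
  proof -
    have "L *v (Z *v u - u) = 0"
      using assms by (simp add: matrix_vector_mult_diff_distrib matrix_vector_mul_assoc)
    then have "orthogonal (Z *v u - u) u"
      using U(1) u by (intro orthogonal_nullspace_rowspace[of L]) auto
    then have "u \<bullet> (Z *v u) = u \<bullet> u"
      by (simp add: orthogonal_def inner_diff_right inner_commute)
    then show ?thesis
      using U(3)[OF u] by (simp add: norm_eq_1)
  qed
  have expand: "Z *v u = (\<Sum>v\<in>B. (u \<bullet> v) *\<^sub>R (Z *v v))" for u
  proof -
    have "Z *v u = Z *v (\<Sum>v\<in>B. (u \<bullet> v) *\<^sub>R v)"
      using B by (simp add: orthonormal_basis_expand)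
    then show ?thesis
      by (simp add: linear_sum[OF matrix_vector_mul_linear] matrix_vector_mult_scaleR)
  qed
  have "real (rank L) = (\<Sum>u\<in>U. u \<bullet> (Z *v u))"
    using uZu U(5) by (simp add: row_rank_def)
  also have "\<dots> = (\<Sum>u\<in>U. \<Sum>v\<in>B. (u \<bullet> v) * (u \<bullet> (Z *v v)))"
    by (subst expand) (simp add: inner_sum_right)
  also have "\<dots> = (\<Sum>v\<in>B. \<Sum>u\<in>U. (u \<bullet> v) * (u \<bullet> (Z *v v)))"
    by (rule sum.swap)
  \<comment> \<open>After the swap, the inner sum over \<open>U\<close> is the projection of the
    unit vector \<open>v\<close> onto the row space of \<open>L\<close>, so Bessel bounds its norm
    by 1.\<close>
  also have "\<dots> = (\<Sum>v\<in>B. (\<Sum>u\<in>U. (u \<bullet> v) *\<^sub>R u) \<bullet> (Z *v v))"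
    by (simp add: inner_sum_left)
  also have "\<dots> \<le> (\<Sum>v\<in>B. norm (Z *v v))"
  proof (rule sum_mono)
    fix v assume "v \<in> B"
    let ?p = "\<Sum>u\<in>U. (u \<bullet> v) *\<^sub>R u"
    have "?p \<bullet> (Z *v v) \<le> norm ?p * norm (Z *v v)"
      by (rule norm_cauchy_schwarz)
    also have "\<dots> \<le> 1 * norm (Z *v v)"
      using norm_orthonormal_expansion_le[OF U(2,3) finU, of v] B(3)[OF \<open>v \<in> B\<close>]
      by (intro mult_right_mono) auto
    finally show "?p \<bullet> (Z *v v) \<le> norm (Z *v v)" by simp
  qed
  finally show ?thesis using B(5) by simp
qed

text \<open>Here \<open>transpose P ** P = P\<close>, so the only possible singular values are 0 and
  1, and the singular space for 1 is the range of \<open>P\<close>.\<close>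

lemma nuclear_norm_orthogonal_projection:
  fixes P :: "real ^ 'n ^ 'n"
  assumes sym: "transpose P = P" and idem: "P ** P = P"
  shows "nuclear_norm P = real (rank P)"
proof -
  have V: "singular_space P s = {v. P *v v = s\<^sup>2 *\<^sub>R v}" for s
    by (simp add: singular_space_def sym idem)
  have "s = 0 \<or> s = 1" if s: "s \<in> singular_values P" for s
  proof -
    obtain v where v: "P *v v = s\<^sup>2 *\<^sub>R v" "v \<noteq> 0" and "0 \<le> s"
      using s by (auto simp: singular_values_def V)
    have "s\<^sup>2 *\<^sub>R (s\<^sup>2 *\<^sub>R v) = s\<^sup>2 *\<^sub>R v"
      by (metis idem matrix_vector_mul_assoc matrix_vector_mult_scaleR v(1))
    then have "s\<^sup>2 * (s\<^sup>2 - 1) = 0"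
      using v(2) by (simp add: algebra_simps)
    then have "s\<^sup>2 = 0 \<or> s\<^sup>2 = 1"
      by (simp only: mult_eq_0_iff right_minus_eq)
    then show ?thesis
      using \<open>0 \<le> s\<close> by (auto simp: power2_eq_1_iff)
  qed
  then have sv: "singular_values P \<subseteq> {0, 1}" by blast
  have "range ((*v) P) = singular_space P 1"
    by (auto simp: V matrix_vector_mul_assoc idem) (metis rangeI)
  then have rank: "rank P = dim (singular_space P 1)"
    by (simp add: rank_dim_range)
  \<comment> \<open>One of 0 and 1 may fail to be a singular value; its space is then trivial, so
    the sum can still run over both.\<close>
  have "dim (singular_space P s) = 0" if "s \<in> {0, 1} - singular_values P" for s
    using that by (auto simp: singular_values_def)
  then have "nuclear_norm P = (\<Sum>s\<in>{0, 1}. real (dim (singular_space P s)) * s)"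
    unfolding nuclear_norm_def using sv by (intro sum.mono_neutral_left) auto
  also have "\<dots> = real (rank P)"
    by (simp add: rank)
  finally show ?thesis .
qed

subsection \<open>The Moore-Penrose pseudo-inverse\<close>

text \<open>A linear map has a linear right inverse on its range; \<open>G\<close> is the matrix of
  such a map.\<close>

lemma generalized_inverse_exists:
  fixes A :: "'a::field ^ 'n ^ 'm"
  shows "\<exists>G. A ** G ** A = A"
proof -
  obtain g where g: "Vector_Spaces.linear (*s) (*s) g" "\<And>x. A *v g (A *v x) = A *v x"
    using vec.linear_exists_right_inverse_on[OF matrix_vector_mul_linear_gen[of A] vec.subspace_UNIV]
    by auto
  have "A ** matrix g ** A = A"
    unfolding matrix_eq by (simp add: g matrix_works flip: matrix_vector_mul_assoc)
  then show ?thesis by blast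
qed

text \<open>The matrices \<open>transpose A ** A\<close> and \<open>A\<close> have the same kernel,
  because \<open>w \<bullet> ((transpose A ** A) *v w)\<close> is the squared norm of
  \<open>A *v w\<close>.\<close>

lemma gram_matrix_cancel:
  fixes A :: "real ^ 'n ^ 'm" and X Y :: "real ^ 'p ^ 'n"
  assumes "transpose A ** A ** X = transpose A ** A ** Y"
  shows "A ** X = A ** Y"
proof -
  have "A *v (X *v v) = A *v (Y *v v)" for v
  proof -
    let ?w = "X *v v - Y *v v"
    have "(transpose A ** A) *v ?w = 0"
      using arg_cong[OF assms, of "\<lambda>M. M *v v"]
      by (simp add: matrix_vector_mult_diff_distrib matrix_vector_mul_assoc)
    then have "(A *v ?w) \<bullet> (A *v ?w) = 0"
      by (metis inner_gram_matrix inner_zero_right)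
    then show ?thesis
      by (simp add: matrix_vector_mult_diff_distrib)
  qed
  then show ?thesis
    unfolding matrix_eq by (simp flip: matrix_vector_mul_assoc)
qed

text \<open>A \<open>{1,3}\<close>-inverse, namely \<open>(A\<^sup>T A)\<^sup>- A\<^sup>T\<close> for a generalized inverse \<open>(A\<^sup>T A)\<^sup>-\<close>.\<close>

lemma least_squares_inverse_exists:
  fixes A :: "real ^ 'n ^ 'm"
  shows "\<exists>B. A ** B ** A = A \<and> transpose (A ** B) = A ** B"
proof -
  let ?T = "transpose A"
  obtain G where G: "(?T ** A) ** G ** (?T ** A) = ?T ** A"
    by (rule exE[OF generalized_inverse_exists[of "?T ** A"]])
  have "A ** (G ** (?T ** A)) = A ** mat 1"
    using G by - (rule gram_matrix_cancel, simp only: matrix_mul_assoc matrix_mul_rid)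
  then have 1: "A ** (G ** ?T) ** A = A"
    by (simp add: matrix_mul_assoc)
  have 2: "?T ** A ** transpose G ** ?T = ?T"
    using arg_cong[OF 1, of transpose] by (simp add: matrix_transpose_mul matrix_mul_assoc)
  \<comment> \<open>\<open>G\<close> is not known to be symmetric. Expanding the last factor by the
    transposed identity and contracting \<open>A ** G ** ?T ** A\<close> to \<open>A\<close>
    replaces \<open>G\<close> by its transpose.\<close>
  have "A ** G ** ?T = A ** G ** (?T ** A ** transpose G ** ?T)"
    by (simp only: 2)
  also have "\<dots> = (A ** (G ** ?T) ** A) ** transpose G ** ?T"
    by (simp only: matrix_mul_assoc)
  also have "\<dots> = transpose (A ** G ** ?T)"
    by (simp only: 1) (simp add: matrix_transpose_mul matrix_mul_assoc)
  finally show ?thesis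
    using 1 by (metis matrix_mul_assoc)
qed

lemma pseudo_inverse_exists: "\<exists>X. is_pseudo_inverse A X"
proof -
  obtain B where B: "A ** B ** A = A" "transpose (A ** B) = A ** B"
    using least_squares_inverse_exists by blast
  obtain D where D: "transpose A ** D ** transpose A = transpose A"
      "transpose (transpose A ** D) = transpose A ** D"
    using least_squares_inverse_exists by blast
  \<comment> \<open>Transposing a \<open>{1,3}\<close>-inverse of \<open>transpose A\<close> gives a
    \<open>{1,4}\<close>-inverse \<open>C\<close> of \<open>A\<close>. In \<open>C ** A ** B\<close>
    the factor \<open>B\<close> supplies the symmetry of \<open>A ** X\<close> and \<open>C\<close>
    that of \<open>X ** A\<close>.\<close>
  define C where "C = transpose D"
  have C: "A ** C ** A = A" "transpose (C ** A) = C ** A"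
    using arg_cong[OF D(1), of transpose] D(2)
    by (simp_all add: C_def matrix_transpose_mul matrix_mul_assoc)
  have AX: "A ** (C ** A ** B) = A ** B"
    by (simp add: C(1) matrix_mul_assoc)
  have XA: "(C ** A ** B) ** A = C ** A"
    by (metis B(1) matrix_mul_assoc)
  have "(C ** A ** B) ** A ** (C ** A ** B) = C ** A ** B"
    by (metis XA AX matrix_mul_assoc)
  then have "is_pseudo_inverse A (C ** A ** B)"
    unfolding is_pseudo_inverse_def by (simp only: AX XA B C)
  then show ?thesis ..
qed

text \<open>Both \<open>A ** X\<close> and \<open>A ** Y\<close> are the orthogonal projection onto
  the range of \<open>A\<close>, hence equal, and similarly \<open>X ** A = Y ** A\<close>. Then
  \<open>X = X ** A ** X = X ** A ** Y = Y ** A ** Y = Y\<close>.\<close>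

lemma pseudo_inverse_unique:
  assumes "is_pseudo_inverse A X" "is_pseudo_inverse A Y"
  shows "X = Y"
proof -
  note X = assms(1)[unfolded is_pseudo_inverse_def] and Y = assms(2)[unfolded is_pseudo_inverse_def]
  have "A ** X = transpose ((A ** Y) ** (A ** X))"
    using X Y by (metis matrix_mul_assoc)
  also have "\<dots> = (A ** X) ** (A ** Y)"
    using X Y by (metis matrix_transpose_mul)
  also have "\<dots> = A ** Y"
    using X by (simp add: matrix_mul_assoc)
  finally have AX: "A ** X = A ** Y" .
  have "X ** A = transpose ((X ** A) ** (Y ** A))"
    using X Y by (metis matrix_mul_assoc)
  also have "\<dots> = (Y ** A) ** (X ** A)"
    using X Y by (metis matrix_transpose_mul)
  also have "\<dots> = Y ** A"
    using X by (metis matrix_mul_assoc)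
  finally have XA: "X ** A = Y ** A" .
  show ?thesis
    using X Y AX XA by (metis matrix_mul_assoc)
qed

lemma is_pseudo_inverse_pseudo_inverse: "is_pseudo_inverse A (pseudo_inverse A)"
  unfolding pseudo_inverse_def
  using pseudo_inverse_exists pseudo_inverse_unique by (metis theI)

lemma mult_pseudo_inverse_mult: "L ** (pseudo_inverse L ** L) = L"
  using is_pseudo_inverse_pseudo_inverse[of L]
  by (simp add: is_pseudo_inverse_def matrix_mul_assoc)

text \<open>The product \<open>?P\<close> is an orthogonal projection. Its rank is that of
  \<open>L\<close> because each of \<open>?P\<close> and \<open>L = L ** ?P\<close> is a left
  multiple of the other.\<close>

lemma nuclear_norm_pseudo_inverse_mult:
  fixes L :: "real ^ 'n ^ 'm"
  shows "nuclear_norm (pseudo_inverse L ** L) = real (rank L)"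
proof -
  let ?P = "pseudo_inverse L ** L"
  have "transpose ?P = ?P" "?P ** ?P = ?P"
    using is_pseudo_inverse_pseudo_inverse[of L] by (simp_all add: is_pseudo_inverse_def matrix_mul_assoc)
  then have "nuclear_norm ?P = real (rank ?P)"
    by (rule nuclear_norm_orthogonal_projection)
  moreover have "rank ?P \<le> rank L"
    by (rule rank_mul_le_right)
  moreover have "rank L \<le> rank ?P"
    by (metis mult_pseudo_inverse_mult rank_mul_le_right)
  ultimately show ?thesis by simp
qed

section \<open>Transfer of optimality between the two problems\<close>

theorem claim1:
  fixes M :: "real ^ 'n ^ 'm" and lam :: real
    and \<omega> :: "'m \<Rightarrow> 'n \<Rightarrow> real ^ 'n ^ 'm" and K_obs :: "('m \<times> 'n) set"
  assumes "lam > 0" and "general_basis \<omega>"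
  shows "(\<forall>L S. MC_solution M lam \<omega> K_obs (L, S) \<longrightarrow>
            LRR_solution M lam \<omega> K_obs (pseudo_inverse L ** L, L, S)) \<and>
         (\<forall>Z L S. LRR_solution M lam \<omega> K_obs (Z, L, S) \<longrightarrow>
            MC_solution M lam \<omega> K_obs (L, S))"
proof (intro conjI allI impI)
  fix L S
  assume "MC_solution M lam \<omega> K_obs (L, S)"
  then have feas: "obs_constraint M \<omega> K_obs L S"
    and opt: "\<And>L' S'. obs_constraint M \<omega> K_obs L' S' \<Longrightarrow>
      real (rank L) + lam * norm_2_1 S \<le> real (rank L') + lam * norm_2_1 S'"
    by (auto simp: MC_solution_def is_arg_min_linorder)
  \<comment> \<open>Dropping \<open>Z'\<close> from an LRR-feasible triple leaves an MC-feasible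
    pair of no greater cost.\<close>
  have "real (rank L) + lam * norm_2_1 S \<le> nuclear_norm Z' + lam * norm_2_1 S'"
    if "L' = L' ** Z'" "obs_constraint M \<omega> K_obs L' S'" for Z' L' S'
    using opt[OF that(2)] rank_le_nuclear_norm[OF that(1)] by linarith
  with feas show "LRR_solution M lam \<omega> K_obs (pseudo_inverse L ** L, L, S)"
    by (auto simp: LRR_solution_def is_arg_min_linorder nuclear_norm_pseudo_inverse_mult
        mult_pseudo_inverse_mult)
next
  fix Z L S
  assume "LRR_solution M lam \<omega> K_obs (Z, L, S)"
  then have feas: "L = L ** Z" "obs_constraint M \<omega> K_obs L S"
    and opt: "\<And>Z' L' S'. L' = L' ** Z' \<Longrightarrow> obs_constraint M \<omega> K_obs L' S' \<Longrightarrow>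
      nuclear_norm Z + lam * norm_2_1 S \<le> nuclear_norm Z' + lam * norm_2_1 S'"
    by (auto simp: LRR_solution_def is_arg_min_linorder)
  \<comment> \<open>The competitor is completed by \<open>Z' = pseudo_inverse L' ** L'\<close>,
    which makes it LRR-feasible at the same cost.\<close>
  have "real (rank L) + lam * norm_2_1 S \<le> real (rank L') + lam * norm_2_1 S'"
    if "obs_constraint M \<omega> K_obs L' S'" for L' S'
    using opt[OF mult_pseudo_inverse_mult[symmetric] that] rank_le_nuclear_norm[OF feas(1)]
    by (simp add: nuclear_norm_pseudo_inverse_mult)
  with feas(2) show "MC_solution M lam \<omega> K_obs (L, S)"
    by (auto simp: MC_solution_def is_arg_min_linorder)
qed

end
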